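(* Fix row indices $i_1<i_2$ and column indices $j_1<j_2$ in $\{1,\dots,n_r\}$, and for $X\in\mathbb{S}^{n_r\times n_r}$ denote the entries of the corresponding $2\times 2$ submatrix by $$X_{[[i_1, i_2], [j_1, j_2]]}= \begin{bmatrix} a & b\\ c & d\end{bmatrix},$$ i.e. $a=X_{i_1j_1}$, $b=X_{i_1j_2}$, $c=X_{i_2j_1}$, $d=X_{i_2j_2}$. For $\lambda=(\lambda_1,\lambda_2)\in\mathbb{R}^2$ with $\|\lambda\|_2=1$ consider the subsets of $\mathbb{S}^{n_r\times n_r}$ described by $$\text{(A)}\quad \lambda_1(a+d)+\lambda_2(b-c) \geq \|(b+c,\,a-d)\|_2, \qquad\qquad \text{(B)}\quad \lambda_1(b+c)+\lambda_2(a-d) \geq \|(a+d,\,b-c)\|_2.$$ (A) describes a maximal outer-product-free set if any of the following holds: (i) $\lambda_1=1,\lambda_2=0$, and neither $b$ nor $c$ is a diagonal entry (of $X$); (ii) $\lambda_1=0,\lambda_2=1$, and $b$ is a diagonal entry; (iii) $\lambda_1=0,\lambda_2=-1$, and $c$ is a diagonal entry; (iv) $\lambda_1^2+\lambda_2^2=1$, and none of $a,b,c,d$ are diagonal entries. Similarly, (B) describes a maximal outer-product-free set if any of the following holds: (v) $\lambda_1=1,\lambda_2=0$, and either $b$ or $c$ is a diagonal entry; (vi) $\lambda_1=0,\lambda_2=1$, and $a$ but not $d$ is a diagonal entry; (vii) $\lambda_1=0,\lambda_2=-1$, and $d$ but not $a$ is a diagonal entry; (viii) $\lambda_1^2+\lambda_2^2=1$,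 and none of $a,b,c,d$ are diagonal entries.
   Context: $\mathbb{S}^{n_r\times n_r}$ is the space of real symmetric $n_r\times n_r$ matrices, where $n_r=\binom{n+r}{r}$ for integers $n,r\ge 1$. Let $S_{OP}:=\{X\in\mathbb{S}^{n_r\times n_r}: X=xx^T,\ x\in\mathbb{R}^{n_r}\}$. A set $C\subseteq\mathbb{S}^{n_r\times n_r}$ is outer-product-free if it is closed and convex and $\mathrm{int}(C)\cap S_{OP}=\emptyset$. An outer-product-free set is maximal if it is not strictly contained in any other outer-product-free set. "Diagonal entry" refers to the position in the full matrix $X$ (e.g. $b$ is a diagonal entry iff $i_1=j_2$). *)

theory Defs
  imports "HOL-Analysis.Analysis"
begin

definition sym_mats :: "(real^'n^'n) set" where
  "sym_mats = {X. transpose X = X}"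

definition S_OP :: "(real^'n^'n) set" where
  "S_OP = {X \<in> sym_mats. \<exists>x :: real^'n. X = (columnvector x :: real^1^'n) ** transpose (columnvector x)}"

(* The ambient space is sym_mats: the interior must be taken in its subspace topology, because
   every subset of sym_mats has empty interior in the type of all square matrices once there
   are at least two indices. *)
definition outer_product_free :: "(real^'n^'n) set \<Rightarrow> bool" where
  "outer_product_free C \<longleftrightarrow>
     closedin (top_of_set sym_mats) C \<and> convex C \<and>
     (top_of_set sym_mats interior_of C) \<inter> S_OP = {}"

definition maximal_outer_product_free :: "(real^'n^'n) set \<Rightarrow> bool" where
  "maximal_outer_product_free C \<longleftrightarrow>
     outer_product_free C \<and> \<not> (\<exists>D. outer_product_free D \<and> C \<subset> D)"

(* The norm on pairs of reals is the Euclidean one. *)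
definition set_A :: "real \<Rightarrow> real \<Rightarrow> 'n \<Rightarrow> 'n \<Rightarrow> 'n \<Rightarrow> 'n \<Rightarrow> (real^'n^'n) set" where
  "set_A l1 l2 i1 i2 j1 j2 = {X \<in> sym_mats.
     let a = X $ i1 $ j1; b = X $ i1 $ j2; c = X $ i2 $ j1; d = X $ i2 $ j2
     in l1 * (a + d) + l2 * (b - c) \<ge> norm (b + c, a - d)}"

definition set_B :: "real \<Rightarrow> real \<Rightarrow> 'n \<Rightarrow> 'n \<Rightarrow> 'n \<Rightarrow> 'n \<Rightarrow> (real^'n^'n) set" where
  "set_B l1 l2 i1 i2 j1 j2 = {X \<in> sym_mats.
     let a = X $ i1 $ j1; b = X $ i1 $ j2; c = X $ i2 $ j1; d = X $ i2 $ j2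
     in l1 * (b + c) + l2 * (a - d) \<ge> norm (a + d, b - c)}"

(* The entry at position (i, j) is a diagonal entry iff i = j.  Thus a, b, c, d are diagonal
   entries iff i1 = j1, i1 = j2, i2 = j1, i2 = j2 respectively. *)

definition cond_A :: "real \<Rightarrow> real \<Rightarrow> 'n \<Rightarrow> 'n \<Rightarrow> 'n \<Rightarrow> 'n \<Rightarrow> bool" where
  "cond_A l1 l2 i1 i2 j1 j2 \<longleftrightarrow>
     (l1 = 1 \<and> l2 = 0 \<and> i1 \<noteq> j2 \<and> i2 \<noteq> j1) \<or>
     (l1 = 0 \<and> l2 = 1 \<and> i1 = j2) \<or>
     (l1 = 0 \<and> l2 = -1 \<and> i2 = j1) \<or>
     (l1\<^sup>2 + l2\<^sup>2 = 1 \<and> i1 \<noteq> j1 \<and> i1 \<noteq> j2 \<and> i2 \<noteq> j1 \<and> i2 \<noteq> j2)"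

definition cond_B :: "real \<Rightarrow> real \<Rightarrow> 'n \<Rightarrow> 'n \<Rightarrow> 'n \<Rightarrow> 'n \<Rightarrow> bool" where
  "cond_B l1 l2 i1 i2 j1 j2 \<longleftrightarrow>
     (l1 = 1 \<and> l2 = 0 \<and> (i1 = j2 \<or> i2 = j1)) \<or>
     (l1 = 0 \<and> l2 = 1 \<and> i1 = j1 \<and> i2 \<noteq> j2) \<or>
     (l1 = 0 \<and> l2 = -1 \<and> i2 = j2 \<and> i1 \<noteq> j1) \<or>
     (l1\<^sup>2 + l2\<^sup>2 = 1 \<and> i1 \<noteq> j1 \<and> i1 \<noteq> j2 \<and> i2 \<noteq> j1 \<and> i2 \<noteq> j2)"

(* The index set {1..n_r} is rendered as an arbitrary finite linearly ordered type with n_r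
   elements; its unique order isomorphism with {1..n_r} carries row and column indices and
   diagonal positions over. *)

end

theory Submission
  imports Defs
begin

text \<open>
  Both families are preimages of a second-order cone: each set consists of the symmetric
  \<open>X\<close> with \<open>norm (v X) \<le> f X\<close>, where \<open>f\<close> is a linear functional and \<open>v\<close> a linear map to the
  plane.  Such a set is closed and convex, and it is a maximal outer-product-free set as soon as
  two things hold (lemma \<open>cone_maximal_outer_product_free\<close>): \<open>f Y \<le> norm (v Y)\<close> for every outer
  product \<open>Y\<close>, and every point of the plane is \<open>v Y\<close> for some outer product \<open>Y\<close> with equality
  there.  Indeed a point \<open>X0\<close> outside the cone lies below the graph of the norm; the outer
  product \<open>Y\<close> on that graph with \<open>v Y = v X0\<close> is straight above \<open>X0\<close>, and the reflection
  \<open>2 Y - X0\<close> of \<open>X0\<close> in \<open>Y\<close> lies strictly inside the cone.  Hence a convex set that contains the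
  cone and \<open>X0\<close> has \<open>Y\<close> in its interior.

  The first property is the Cauchy-Schwarz inequality together with the identity
  \<open>(a + d)\<^sup>2 + (b - c)\<^sup>2 = (b + c)\<^sup>2 + (a - d)\<^sup>2 + 4 (a d - b c)\<close>, since \<open>a d = b c\<close> for an outer
  product.

  For the second property, let \<open>X\<close> be the outer product of \<open>x\<close> with itself, and read the pairs
  of coordinates as complex numbers
  \<open>\<alpha> = x\<^bsub>i1\<^esub> + \<i> x\<^bsub>i2\<^esub>\<close> and \<open>\<beta> = x\<^bsub>j1\<^esub> + \<i> x\<^bsub>j2\<^esub>\<close>.  Then
  \<open>\<alpha> \<beta> = (a - d) + \<i> (b + c)\<close> and \<open>\<alpha> cnj \<beta> = (a + d) - \<i> (b - c)\<close>.  For (A), equality with a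
  given \<open>w = \<alpha> \<beta>\<close> holds when \<open>\<alpha> cnj \<beta> = cmod w \<mu>\<close> with \<open>\<mu> = l1 - \<i> l2\<close>, and this is
  achieved by \<open>\<alpha>\<^sup>2 = w \<mu>\<close>, \<open>\<beta> = \<alpha> cnj \<mu>\<close>; (B) is the same after conjugating \<open>\<beta>\<close>.  The conditions
  on diagonal entries ensure that \<open>\<alpha>\<close> and \<open>\<beta>\<close> come from one vector \<open>x\<close>: whenever a row index
  coincides with a column index, the relation between \<open>\<alpha>\<close> and \<open>\<beta>\<close> makes the two values
  prescribed for that coordinate of \<open>x\<close> agree.
\<close>

section \<open>Cones over the norm\<close>

lemma linear_combination_sym_mats:
  assumes "X \<in> sym_mats" "Y \<in> sym_mats"
  shows "s *\<^sub>R X + t *\<^sub>R Y \<in> sym_mats"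
  using assms by (simp add: sym_mats_def transpose_def vec_eq_iff)

text \<open>
  Maximality is the reflection argument.  Outer-product-freeness needs a direction that leaves
  the cone from every outer product in it, and since the interior is relative to the symmetric
  matrices, on which the entries seen by \<open>f\<close> and \<open>v\<close> need not be independent, that direction
  has to be found among them.  The sum \<open>W\<close> of two tight outer products over opposite nonzero
  points lies strictly inside the cone, so \<open>- W\<close> is one.
\<close>

lemma cone_maximal_outer_product_free:
  fixes f :: "real^'n^'n \<Rightarrow> real" and v :: "real^'n^'n \<Rightarrow> 'b::real_normed_vector"
  assumes f: "linear f" and v: "linear v"
    and nontrivial: "\<exists>e :: 'b. e \<noteq> 0"
    and below: "\<And>Y. Y \<in> S_OP \<Longrightarrow> f Y \<le> norm (v Y)"
    and tight: "\<And>w. \<exists>Y \<in> S_OP. v Y = w \<and> f Y = norm w"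
  shows "maximal_outer_product_free {X \<in> sym_mats. norm (v X) \<le> f X}"
proof -
  define C where "C = {X \<in> sym_mats. norm (v X) \<le> f X}"
  have cf: "continuous_on S f" and cv: "continuous_on S v" for S
    using f v by (auto intro: linear_continuous_on simp: linear_conv_bounded_linear)
  have outer_sym: "S_OP \<subseteq> (sym_mats :: (real^'n^'n) set)"
    by (auto simp: S_OP_def)
  have "closed {X. norm (v X) \<le> f X}"
    by (intro closed_Collect_le continuous_on_norm cf cv)
  then have "closedin (top_of_set sym_mats) C"
    unfolding C_def closedin_closed by blast
  moreover have "convex C"
  proof (rule convexI)
    fix X Y :: "real^'n^'n" and s t :: real
    assume XY: "X \<in> C" "Y \<in> C" and st: "0 \<le> s" "0 \<le> t" "s + t = 1"
    have "norm (v (s *\<^sub>R X + t *\<^sub>R Y)) \<le> s * norm (v X) + t * norm (v Y)"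
      using st norm_triangle_ineq[of "s *\<^sub>R v X" "t *\<^sub>R v Y"]
      by (simp add: linear_add[OF v] linear_scale[OF v])
    also have "\<dots> \<le> s * f X + t * f Y"
      using XY st by (intro add_mono mult_left_mono) (auto simp: C_def)
    finally show "s *\<^sub>R X + t *\<^sub>R Y \<in> C"
      using XY by (simp add: C_def linear_combination_sym_mats linear_add[OF f] linear_scale[OF f])
  qed
  moreover have "top_of_set sym_mats interior_of C \<inter> S_OP = {}"
  proof (rule ccontr)
    assume "\<not> ?thesis"
    then obtain Y where Y: "Y \<in> top_of_set sym_mats interior_of C" "Y \<in> S_OP" by blast
    then obtain T where T: "openin (top_of_set sym_mats) T" "Y \<in> T" "T \<subseteq> C"
      by (auto simp: interior_of_def)
    obtain \<epsilon> where \<epsilon>: "\<epsilon> > 0" "\<And>Z. Z \<in> sym_mats \<Longrightarrow> dist Z Y < \<epsilon> \<Longrightarrow> Z \<in> C"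
      using T unfolding openin_euclidean_subtopology_iff by blast
    obtain e :: 'b where e: "e \<noteq> 0" using nontrivial by blast
    obtain P Q where PQ: "P \<in> S_OP" "Q \<in> S_OP" "v P = e" "v Q = - e"
      "f P = norm e" "f Q = norm e"
      using tight[of e] tight[of "- e"] by (metis norm_minus_cancel)
    define W where "W = P + Q"
    have W: "W \<in> sym_mats" "v W = 0" "f W > 0"
      using PQ e outer_sym linear_combination_sym_mats[of P Q 1 1]
      by (auto simp: W_def linear_add[OF v] linear_add[OF f])
    define \<delta> where "\<delta> = \<epsilon> / (2 * (norm W + 1))"
    have pos: "norm W + 1 > 0" by (simp add: add_nonneg_pos)
    have "\<delta> > 0" using \<epsilon>(1) pos by (simp add: \<delta>_def)
    have "\<delta> * norm W \<le> \<delta> * (norm W + 1)"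
      using \<open>\<delta> > 0\<close> by simp
    also have "\<dots> = \<epsilon> / 2" using pos by (simp add: \<delta>_def field_simps)
    also have "\<dots> < \<epsilon>" using \<epsilon>(1) by simp
    finally have "dist (Y - \<delta> *\<^sub>R W) Y < \<epsilon>"
      using \<open>\<delta> > 0\<close> by (simp add: dist_norm)
    moreover have "Y - \<delta> *\<^sub>R W \<in> sym_mats"
      using linear_combination_sym_mats[of Y W 1 "- \<delta>"] Y W outer_sym by auto
    ultimately have "norm (v (Y - \<delta> *\<^sub>R W)) \<le> f (Y - \<delta> *\<^sub>R W)"
      using \<epsilon>(2) by (auto simp: C_def)
    then have "norm (v Y) \<le> f Y - \<delta> * f W"
      using W by (simp add: linear_diff[OF v] linear_diff[OF f] linear_scale[OF v] linear_scale[OF f])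
    moreover have "\<delta> * f W > 0" using \<open>\<delta> > 0\<close> W by simp
    ultimately show False using below[OF Y(2)] by linarith
  qed
  ultimately have free: "outer_product_free C"
    by (simp add: outer_product_free_def)
  have "\<not> outer_product_free D" if CD: "C \<subset> D" for D
  proof
    assume D: "outer_product_free D"
    then have D_sym: "D \<subseteq> sym_mats" and "convex D"
      by (auto simp: outer_product_free_def dest: closedin_imp_subset)
    obtain X0 where X0: "X0 \<in> D" "X0 \<notin> C" using CD by blast
    then have X0_below: "X0 \<in> sym_mats" "f X0 < norm (v X0)"
      using D_sym by (auto simp: C_def)
    obtain Y where Y: "Y \<in> S_OP" "v Y = v X0" "f Y = norm (v X0)"
      using tight by blast
    \<comment> \<open>The points whose reflection of \<open>X0\<close> is strictly inside the cone.\<close>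
    define T where "T = sym_mats \<inter> {Z. norm (v (2 *\<^sub>R Z - X0)) < f (2 *\<^sub>R Z - X0)}"
    have "open {Z. norm (v (2 *\<^sub>R Z - X0)) < f (2 *\<^sub>R Z - X0)}"
      by (intro open_Collect_less continuous_on_norm continuous_on_compose2[OF cv[of UNIV]]
          continuous_on_compose2[OF cf[of UNIV]] continuous_intros) auto
    then have "openin (top_of_set sym_mats) T"
      unfolding T_def by (rule openin_open_Int)
    moreover have "T \<subseteq> D"
    proof
      fix Z assume Z: "Z \<in> T"
      then have "2 *\<^sub>R Z - X0 \<in> C"
        using linear_combination_sym_mats[of Z X0 2 "- 1"] X0_below
        by (auto simp: T_def C_def)
      then have "(1/2) *\<^sub>R X0 + (1/2) *\<^sub>R (2 *\<^sub>R Z - X0) \<in> D"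
        using CD X0 by (intro convexD[OF \<open>convex D\<close>]) auto
      then show "Z \<in> D" by (simp add: algebra_simps)
    qed
    moreover have "Y \<in> T"
    proof -
      have "v (2 *\<^sub>R Y - X0) = 2 *\<^sub>R v Y - v X0" "f (2 *\<^sub>R Y - X0) = 2 *\<^sub>R f Y - f X0"
        by (simp_all only: linear_diff[OF v] linear_diff[OF f] linear_scale[OF v] linear_scale[OF f])
      then have "norm (v (2 *\<^sub>R Y - X0)) < f (2 *\<^sub>R Y - X0)"
        using Y X0_below by (simp add: scaleR_2)
      then show ?thesis using Y outer_sym by (auto simp: T_def)
    qed
    ultimately have "Y \<in> top_of_set sym_mats interior_of D"
      by (auto simp: interior_of_def)
    then show False using D Y(1) by (auto simp: outer_product_free_def)
  qed
  then show ?thesis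
    using free unfolding maximal_outer_product_free_def C_def by blast
qed

section \<open>Outer products seen through a two by two submatrix\<close>

lemma S_OP_eq: "S_OP = range (\<lambda>x :: real^'n. \<chi> i j. x $ i * x $ j)"
proof -
  have "(columnvector x :: real^1^'n) ** transpose (columnvector x) = (\<chi> i j. x $ i * x $ j)" for x :: "real^'n"
    by (simp add: vec_eq_iff matrix_matrix_mult_def columnvector_def transpose_def)
  moreover have "(\<chi> i j. x $ i * x $ j) \<in> sym_mats" for x :: "real^'n"
    by (simp add: sym_mats_def transpose_def vec_eq_iff mult.commute)
  ultimately show ?thesis by (auto simp: S_OP_def)
qed

lemma S_OP_submatrix_singular:
  assumes "Y \<in> S_OP"
  shows "Y $ i1 $ j1 * Y $ i2 $ j2 = Y $ i1 $ j2 * Y $ i2 $ j1"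
  using assms by (auto simp: S_OP_eq)

lemma S_OP_with_factors:
  fixes i1 i2 j1 j2 :: "'n::finite"
  assumes "i1 \<noteq> i2" "j1 \<noteq> j2"
    and "i1 = j1 \<Longrightarrow> s = y" "i1 = j2 \<Longrightarrow> s = z" "i2 = j1 \<Longrightarrow> t = y" "i2 = j2 \<Longrightarrow> t = z"
  obtains Y :: "real^'n^'n" where "Y \<in> S_OP"
    "Y $ i1 $ j1 = s * y" "Y $ i1 $ j2 = s * z" "Y $ i2 $ j1 = t * y" "Y $ i2 $ j2 = t * z"
proof -
  define x :: "real^'n"
    where "x = (\<chi> k. if k = i1 then s else if k = i2 then t else if k = j1 then y else z)"
  have "x $ i1 = s" "x $ i2 = t" "x $ j1 = y" "x $ j2 = z"
    using assms by (auto simp: x_def)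
  then show ?thesis
    using that[of "\<chi> i j. x $ i * x $ j"] by (simp add: S_OP_eq)
qed

section \<open>Tight outer products from complex square roots\<close>

text \<open>
  With \<open>\<alpha> = s + \<i> t\<close> and a unit \<open>\<nu> = l1 + \<i> l2\<close> this solves \<open>\<nu> \<alpha>\<^sup>2 = q + \<i> p\<close>.
\<close>

lemma rotated_square_root:
  fixes l1 l2 p q :: real
  assumes unit: "l1\<^sup>2 + l2\<^sup>2 = 1"
  obtains s t :: real where
    "p = l1 * (2 * s * t) + l2 * (s\<^sup>2 - t\<^sup>2)" "q = l1 * (s\<^sup>2 - t\<^sup>2) - l2 * (2 * s * t)"
    "norm (p, q) = s\<^sup>2 + t\<^sup>2"
proof -
  define \<nu> where "\<nu> = Complex l1 l2"
  define \<alpha> where "\<alpha> = csqrt (Complex q p * cnj \<nu>)"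
  have unit': "\<nu> * cnj \<nu> = 1" "cmod \<nu> = 1"
    using unit by (simp_all add: \<nu>_def complex_eq_iff power2_eq_square cmod_def)
  have sq: "\<alpha>\<^sup>2 = Complex q p * cnj \<nu>"
    by (simp add: \<alpha>_def)
  have eq: "\<nu> * \<alpha>\<^sup>2 = Complex q p"
    using unit' by (simp add: sq mult.left_commute)
  have "norm (p, q) = cmod (\<nu> * \<alpha>\<^sup>2)"
    unfolding eq by (simp add: norm_Pair cmod_def add.commute)
  also have "\<dots> = (cmod \<alpha>)\<^sup>2"
    by (simp add: unit' norm_mult norm_power)
  also have "\<dots> = (Re \<alpha>)\<^sup>2 + (Im \<alpha>)\<^sup>2"
    by (rule cmod_power2)
  finally have "norm (p, q) = (Re \<alpha>)\<^sup>2 + (Im \<alpha>)\<^sup>2" .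
  moreover have "q = l1 * ((Re \<alpha>)\<^sup>2 - (Im \<alpha>)\<^sup>2) - l2 * (2 * Re \<alpha> * Im \<alpha>)"
    using arg_cong[OF eq, of Re] by (simp add: \<nu>_def power2_eq_square algebra_simps)
  moreover have "p = l1 * (2 * Re \<alpha> * Im \<alpha>) + l2 * ((Re \<alpha>)\<^sup>2 - (Im \<alpha>)\<^sup>2)"
    using arg_cong[OF eq, of Im] by (simp add: \<nu>_def power2_eq_square algebra_simps)
  ultimately show ?thesis using that by blast
qed

lemma unit_combination_le_norm:
  fixes l1 l2 p q :: real
  assumes "l1\<^sup>2 + l2\<^sup>2 = 1"
  shows "l1 * p + l2 * q \<le> norm (p, q)"
  using norm_cauchy_schwarz[of "(l1, l2)" "(p, q)"] assms by (simp add: norm_Pair)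

text \<open>
  The column factor is \<open>\<beta> = \<nu> \<alpha>\<close>, with \<open>\<nu> = l1 + \<i> l2\<close>.  For \<open>\<nu> = 1\<close> this is \<open>\<beta> = \<alpha>\<close>,
  which allows \<open>i1 = j1\<close> and \<open>i2 = j2\<close>; for \<open>\<nu> = \<i>\<close> and \<open>\<nu> = - \<i>\<close> it is a quarter turn,
  which allows \<open>i1 = j2\<close> and \<open>i2 = j1\<close> respectively.
\<close>

lemma set_A_maximal:
  fixes i1 i2 j1 j2 :: "'n::{finite,linorder}"
  assumes ind: "i1 < i2" "j1 < j2" and unit: "l1\<^sup>2 + l2\<^sup>2 = 1"
    and cond: "cond_A l1 l2 i1 i2 j1 j2"
  shows "maximal_outer_product_free (set_A l1 l2 i1 i2 j1 j2)"
proof -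
  let ?f = "\<lambda>X :: ((real, 'n) vec, 'n) vec. l1 * (X $ i1 $ j1 + X $ i2 $ j2) + l2 * (X $ i1 $ j2 - X $ i2 $ j1)"
  let ?v = "\<lambda>X :: ((real, 'n) vec, 'n) vec. (X $ i1 $ j2 + X $ i2 $ j1, X $ i1 $ j1 - X $ i2 $ j2)"
  have "maximal_outer_product_free {X \<in> sym_mats. norm (?v X) \<le> ?f X}"
  proof (rule cone_maximal_outer_product_free)
    show "linear ?f" "linear ?v"
      by (auto intro!: linearI simp: algebra_simps)
    show "\<exists>e :: real \<times> real. e \<noteq> 0"
      by (rule exI[of _ "(1, 0)"]) (simp add: zero_prod_def)
    show "?f Y \<le> norm (?v Y)" if "Y \<in> S_OP" for Y
    proof -
      have "norm (Y $ i1 $ j1 + Y $ i2 $ j2, Y $ i1 $ j2 - Y $ i2 $ j1) = norm (?v Y)"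
        using S_OP_submatrix_singular[OF that, of i1 j1 i2 j2]
        by (simp add: norm_Pair power2_eq_square algebra_simps)
      then show ?thesis using unit_combination_le_norm[OF unit] by metis
    qed
    show "\<exists>Y \<in> S_OP. ?v Y = w \<and> ?f Y = norm w" for w
    proof -
      obtain p q where w: "w = (p, q)" by (cases w)
      obtain s t where st: "p = l1 * (2 * s * t) + l2 * (s\<^sup>2 - t\<^sup>2)"
        "q = l1 * (s\<^sup>2 - t\<^sup>2) - l2 * (2 * s * t)" "norm (p, q) = s\<^sup>2 + t\<^sup>2"
        using rotated_square_root[OF unit] by blast
      obtain Y :: "((real, 'n) vec, 'n) vec" where Y: "Y \<in> S_OP"
        "Y $ i1 $ j1 = s * (l1 * s - l2 * t)" "Y $ i1 $ j2 = s * (l2 * s + l1 * t)"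
        "Y $ i2 $ j1 = t * (l1 * s - l2 * t)" "Y $ i2 $ j2 = t * (l2 * s + l1 * t)"
        by (rule S_OP_with_factors[of i1 i2 j1 j2 s "l1 * s - l2 * t" "l2 * s + l1 * t" t])
          (use ind cond in \<open>auto simp: cond_A_def\<close>)
      have "?v Y = w"
        unfolding w st Y by (simp add: power2_eq_square algebra_simps)
      moreover have "?f Y = (l1\<^sup>2 + l2\<^sup>2) * (s\<^sup>2 + t\<^sup>2)"
        unfolding Y by (simp add: power2_eq_square algebra_simps)
      ultimately show ?thesis using Y(1) unit st(3) w by auto
    qed
  qed
  then show ?thesis by (simp add: set_A_def Let_def)
qed

text \<open>
  Here the column factor is \<open>\<beta> = \<mu> cnj \<alpha>\<close> with \<open>\<mu> = l2 + \<i> l1\<close>, a reflection of \<open>\<alpha>\<close> in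
  place of a rotation.  For \<open>\<mu> = \<i>\<close> it swaps the two coordinates, which allows \<open>i1 = j2\<close> and
  \<open>i2 = j1\<close>; for \<open>\<mu> = 1\<close> it negates the second one and allows \<open>i1 = j1\<close>, for \<open>\<mu> = - 1\<close> it
  negates the first one and allows \<open>i2 = j2\<close>.
\<close>

lemma set_B_maximal:
  fixes i1 i2 j1 j2 :: "'n::{finite,linorder}"
  assumes ind: "i1 < i2" "j1 < j2" and unit: "l1\<^sup>2 + l2\<^sup>2 = 1"
    and cond: "cond_B l1 l2 i1 i2 j1 j2"
  shows "maximal_outer_product_free (set_B l1 l2 i1 i2 j1 j2)"
proof -
  let ?f = "\<lambda>X :: ((real, 'n) vec, 'n) vec. l1 * (X $ i1 $ j2 + X $ i2 $ j1) + l2 * (X $ i1 $ j1 - X $ i2 $ j2)"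
  let ?v = "\<lambda>X :: ((real, 'n) vec, 'n) vec. (X $ i1 $ j1 + X $ i2 $ j2, X $ i1 $ j2 - X $ i2 $ j1)"
  have "maximal_outer_product_free {X \<in> sym_mats. norm (?v X) \<le> ?f X}"
  proof (rule cone_maximal_outer_product_free)
    show "linear ?f" "linear ?v"
      by (auto intro!: linearI simp: algebra_simps)
    show "\<exists>e :: real \<times> real. e \<noteq> 0"
      by (rule exI[of _ "(1, 0)"]) (simp add: zero_prod_def)
    show "?f Y \<le> norm (?v Y)" if "Y \<in> S_OP" for Y
    proof -
      have "norm (Y $ i1 $ j2 + Y $ i2 $ j1, Y $ i1 $ j1 - Y $ i2 $ j2) = norm (?v Y)"
        using S_OP_submatrix_singular[OF that, of i1 j1 i2 j2]
        by (simp add: norm_Pair power2_eq_square algebra_simps)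
      then show ?thesis using unit_combination_le_norm[OF unit] by metis
    qed
    show "\<exists>Y \<in> S_OP. ?v Y = w \<and> ?f Y = norm w" for w
    proof -
      obtain p q where w: "w = (p, q)" by (cases w)
      \<comment> \<open>Now \<open>\<alpha> cnj \<beta> = \<alpha>\<^sup>2 cnj \<mu> = p - \<i> q\<close>, where \<open>cnj \<mu> = l2 - \<i> l1\<close>.\<close>
      have "l2\<^sup>2 + (- l1)\<^sup>2 = 1" using unit by simp
      then obtain s t where st: "- q = l2 * (2 * s * t) + (- l1) * (s\<^sup>2 - t\<^sup>2)"
        "p = l2 * (s\<^sup>2 - t\<^sup>2) - (- l1) * (2 * s * t)" "norm (- q, p) = s\<^sup>2 + t\<^sup>2"
        by (rule rotated_square_root)
      have norm_w: "norm w = s\<^sup>2 + t\<^sup>2"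
        using st(3) by (simp add: w norm_Pair add.commute)
      obtain Y :: "((real, 'n) vec, 'n) vec" where Y: "Y \<in> S_OP"
        "Y $ i1 $ j1 = s * (l2 * s + l1 * t)" "Y $ i1 $ j2 = s * (l1 * s - l2 * t)"
        "Y $ i2 $ j1 = t * (l2 * s + l1 * t)" "Y $ i2 $ j2 = t * (l1 * s - l2 * t)"
        by (rule S_OP_with_factors[of i1 i2 j1 j2 s "l2 * s + l1 * t" "l1 * s - l2 * t" t])
          (use ind cond in \<open>auto simp: cond_B_def\<close>)
      have "q = l1 * (s\<^sup>2 - t\<^sup>2) - l2 * (2 * s * t)" using st(1) by simp
      then have "?v Y = w"
        unfolding w Y st(2) by (simp add: power2_eq_square algebra_simps)
      moreover have "?f Y = (l1\<^sup>2 + l2\<^sup>2) * (s\<^sup>2 + t\<^sup>2)"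
        unfolding Y by (simp add: power2_eq_square algebra_simps)
      ultimately show ?thesis using Y(1) unit norm_w by auto
    qed
  qed
  then show ?thesis by (simp add: set_B_def Let_def)
qed

theorem theorem23:
  fixes n r :: nat
    and i1 i2 j1 j2 :: "'m::{finite,linorder}"
    and l1 l2 :: real
  assumes "n \<ge> 1" and "r \<ge> 1"
    and "CARD('m) = (n + r) choose r"
    and "i1 < i2" and "j1 < j2"
    and "norm (l1, l2) = 1"
  shows "(cond_A l1 l2 i1 i2 j1 j2 \<longrightarrow> maximal_outer_product_free (set_A l1 l2 i1 i2 j1 j2)) \<and>
         (cond_B l1 l2 i1 i2 j1 j2 \<longrightarrow> maximal_outer_product_free (set_B l1 l2 i1 i2 j1 j2))"
proof -
  have "l1\<^sup>2 + l2\<^sup>2 = 1" using assms(6) by (simp add: norm_Pair)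
  then show ?thesis
    using set_A_maximal[OF assms(4,5)] set_B_maximal[OF assms(4,5)] by blast
qed

end
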